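(* For every integer $n\geq 0$, \[|\mathrm{flat}(\mathcal{Q}_{n+1})| = \sum_{i=0}^{n}\binom{n}{i}\sum_{k=0}^{n-i} 2^{n-i-k}\, S(n-i,k).\]
   Context: A Stirling permutation of order $N$ is a word $w=w_1w_2\cdots w_{2N}$ in which every letter of $\{1,\dots,N\}$ appears exactly twice and such that, for each $i$, every letter appearing between the two occurrences of $i$ is greater than $i$. $\mathcal{Q}_N$ is the set of Stirling permutations of order $N$. The runs of $w\in\mathcal{Q}_N$ are its maximal contiguous weakly increasing subwords. $w$ is flattened if the sequence of leading (first) terms of its runs, read from left to right, is weakly increasing. $\mathrm{flat}(\mathcal{Q}_N)$ is the set of flattened elements of $\mathcal{Q}_N$. $S(a,b)$ denotes the Stirling number of the second kind (the number of partitions of an $a$-element set into $b$ nonempty blocks), with the usual conventions $S(0,0)=1$ and $S(a,0)=0$ for $a\geq 1$. *)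

theory Defs
  imports "HOL-Combinatorics.Stirling"
begin

definition stirling_permutations :: "nat \<Rightarrow> nat list set" where
  "stirling_permutations N =
    {w. length w = 2 * N \<and> set w \<subseteq> {1..N} \<and> (\<forall>i\<in>{1..N}. count_list w i = 2) \<and>
        (\<forall>p q r. p < q \<and> q < r \<and> r < length w \<and> w ! p = w ! r \<longrightarrow> w ! p < w ! q)}"

text \<open>Zero-based positions are used; \<open>subword w i j\<close> is the nonempty factor occupying the
  positions \<open>i, \<dots>, j\<close> (both included) when \<open>i \<le> j < length w\<close>.\<close>

definition subword :: "'a list \<Rightarrow> nat \<Rightarrow> nat \<Rightarrow> 'a list" where
  "subword w i j = take (Suc j - i) (drop i w)"

definition increasing_at :: "'a::linorder list \<Rightarrow> nat \<Rightarrow> nat \<Rightarrow> bool" where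
  "increasing_at w i j \<longleftrightarrow> i \<le> j \<and> j < length w \<and> sorted (subword w i j)"

definition run_at :: "'a::linorder list \<Rightarrow> nat \<Rightarrow> nat \<Rightarrow> bool" where
  "run_at w i j \<longleftrightarrow> increasing_at w i j \<and>
    (\<forall>i' j'. i' \<le> i \<and> j \<le> j' \<and> increasing_at w i' j' \<longrightarrow> i' = i \<and> j' = j)"

text \<open>Distinct runs start at distinct positions, so selecting the starting positions in increasing
  order lists the leading terms of the runs from left to right, one for each run.\<close>

definition run_leaders :: "'a::linorder list \<Rightarrow> 'a list" where
  "run_leaders w = map (\<lambda>i. w ! i) (filter (\<lambda>i. \<exists>j. run_at w i j) [0..<length w])"

definition flattened :: "'a::linorder list \<Rightarrow> bool" where
  "flattened w \<longleftrightarrow> sorted (run_leaders w)"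

definition flat :: "'a::linorder list set \<Rightarrow> 'a list set" where
  "flat Q = {w \<in> Q. flattened w}"

lemma finite_stirling_permutations: "finite (stirling_permutations N)"
  by (rule finite_subset[OF _ finite_lists_length_eq[of "{1..N}" "2 * N"]])
     (auto simp: stirling_permutations_def)

end

theory Submission
  imports Defs "HOL-Library.Multiset"
begin

text \<open>
  The leaders of the runs after the first one are exactly the letters that are smaller than their
  predecessors. Let \<open>m\<close> be the least letter of a Stirling word \<open>w\<close> over a finite nonempty alphabet
  \<open>S\<close>, and write \<open>w = u m v m y\<close>, where \<open>u\<close>, \<open>v\<close>, \<open>y\<close> do not contain \<open>m\<close>.
  The nesting condition forbids a letter other than \<open>m\<close> to occur on both sides of an \<open>m\<close>, so \<open>u\<close>, \<open>v\<close>,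
  \<open>y\<close> are Stirling words over disjoint alphabets \<open>C\<close>, \<open>A\<close>, \<open>R\<close> that partition \<open>S - {m}\<close>.

  Call \<open>w\<close> tail-flattened if the leaders of its runs after the first one increase weakly. If \<open>u\<close> is
  nonempty, the first \<open>m\<close> is preceded by a larger letter and hence leads a run; any leader
  between the first run and this one would exceed it, so \<open>u\<close> must lie in the first run, that is, be
  sorted. The same argument applied to the second \<open>m\<close> shows that \<open>v\<close> is sorted, and what
  remains to be asked is that \<open>y\<close> be
  tail-flattened (\<open>sorted_descent_bottoms_blocks\<close>). A sorted Stirling word \<open>a a b b c c \<dots>\<close> is
  determined by its alphabet, so tail-flattened words over \<open>S\<close> correspond to triples of a set
  \<open>R \<subseteq> S - {m}\<close>, a subset \<open>C\<close> of the other letters, and a tail-flattened word over \<open>R\<close>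
  (\<open>bij_betw_assemble\<close>). With \<open>n = card S - 1\<close> this gives the recurrence
  \<open>b (n + 1) = (\<Sum>j\<le>n. (n choose j) * 2 ^ (n - j) * b j)\<close> for their number.

  The inner sum of the theorem, \<open>(\<Sum>k\<le>n. 2 ^ (n - k) * Stirling n k)\<close>, satisfies the same recurrence,
  by the identity \<open>Stirling (n + 1) (k + 1) = (\<Sum>j\<le>n. (n choose j) * Stirling j k)\<close>. Finally,
  a word is flattened exactly when it is tail-flattened and starts with \<open>m\<close>, that is, when \<open>C\<close> is
  empty; summing \<open>b (card R)\<close> over all \<open>R\<close> yields the outer binomial sum.
\<close>

section \<open>Binomial sums of Stirling numbers\<close>

lemma sum_binomial_Suc:
  fixes f :: "nat \<Rightarrow> nat"
  shows "(\<Sum>j\<le>Suc n. (Suc n choose j) * f j) = (\<Sum>j\<le>n. (n choose j) * (f j + f (Suc j)))"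
proof -
  have "(\<Sum>j\<le>n. (n choose j) * f j) = (\<Sum>j\<le>Suc n. (n choose j) * f j)"
    by simp
  also have "\<dots> = f 0 + (\<Sum>j\<le>n. (n choose Suc j) * f (Suc j))"
    by (subst sum.atMost_Suc_shift) simp
  finally show ?thesis
    by (subst sum.atMost_Suc_shift) (simp add: sum.distrib algebra_simps)
qed

text \<open>The combinatorial reason: remove the block of the last of \<open>n + 1\<close> elements; the index \<open>j\<close> is
  the number of elements outside it.\<close>
lemma Stirling_Suc_Suc_eq_sum:
  "Stirling (Suc n) (Suc k) = (\<Sum>j\<le>n. (n choose j) * Stirling j k)"
proof (induction n arbitrary: k)
  case 0
  show ?case by (cases k) simp_all
next
  case (Suc n)
  show ?case
  proof (cases k)
    case 0
    then show ?thesis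
      using Suc[of 0] by (simp add: sum_binomial_Suc del: sum.atMost_Suc binomial_Suc_Suc)
  next
    case (Suc k')
    have "(\<Sum>j\<le>Suc n. (Suc n choose j) * Stirling j k) =
        Suc k * (\<Sum>j\<le>n. (n choose j) * Stirling j k) + (\<Sum>j\<le>n. (n choose j) * Stirling j k')"
      unfolding sum_binomial_Suc sum_distrib_left sum.distrib[symmetric]
      using Suc by (intro sum.cong) (simp_all add: algebra_simps)
    also have "\<dots> = Suc k * Stirling (Suc n) (Suc k) + Stirling (Suc n) k"
      using Suc.IH[of k] Suc.IH[of k'] Suc by (simp del: Stirling.simps)
    finally show ?thesis
      by simp
  qed
qed

text \<open>Bell numbers in which a block of size \<open>s\<close> carries the weight \<open>2 ^ (s - 1)\<close>.\<close>
definition weighted_Bell :: "nat \<Rightarrow> nat" where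
  "weighted_Bell n = (\<Sum>k\<le>n. 2 ^ (n - k) * Stirling n k)"

text \<open>Since \<open>n + 1 - (k + 1) = (n - j) + (j - k)\<close>, the weights in the expansion of
  \<open>Stirling (n + 1) (k + 1)\<close> split into a factor for the removed block and one for the rest.\<close>
lemma weighted_Bell_Suc:
  "weighted_Bell (Suc n) = (\<Sum>j\<le>n. (n choose j) * (2 ^ (n - j) * weighted_Bell j))"
proof -
  have "weighted_Bell (Suc n) = (\<Sum>k\<le>n. 2 ^ (n - k) * Stirling (Suc n) (Suc k))"
    unfolding weighted_Bell_def by (subst sum.atMost_Suc_shift) simp
  also have "\<dots> = (\<Sum>k\<le>n. \<Sum>j\<le>n. 2 ^ (n - k) * ((n choose j) * Stirling j k))"
    by (simp add: Stirling_Suc_Suc_eq_sum sum_distrib_left del: Stirling.simps)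
  also have "\<dots> = (\<Sum>j\<le>n. \<Sum>k\<le>n. 2 ^ (n - k) * ((n choose j) * Stirling j k))"
    by (rule sum.swap)
  also have "\<dots> = (\<Sum>j\<le>n. \<Sum>k\<le>j. 2 ^ (n - k) * ((n choose j) * Stirling j k))"
    by (intro sum.cong refl sum.mono_neutral_right) auto
  also have "\<dots> = (\<Sum>j\<le>n. (n choose j) * (2 ^ (n - j) * weighted_Bell j))"
    by (auto simp: weighted_Bell_def sum_distrib_left ac_simps simp flip: power_add intro!: sum.cong)
  finally show ?thesis .
qed

lemma sum_Pow_card:
  fixes h :: "nat \<Rightarrow> nat"
  assumes "finite X"
  shows "(\<Sum>R\<in>Pow X. h (card R)) = (\<Sum>j\<le>card X. (card X choose j) * h j)"
proof -
  have "(\<Sum>R\<in>Pow X. h (card R)) = (\<Sum>j\<le>card X. \<Sum>R\<in>{R \<in> Pow X. card R = j}. h (card R))"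
    using assms by (intro sum.group[symmetric]) (auto intro: card_mono)
  also have "\<dots> = (\<Sum>j\<le>card X. (card X choose j) * h j)"
    using n_subsets[OF assms] by (intro sum.cong) simp_all
  finally show ?thesis .
qed

section \<open>Runs and descents\<close>

text \<open>The parameter \<open>p\<close> plays the role of a letter in front of the word; carrying it along makes the
  function behave well under concatenation.\<close>
fun descent_bottoms :: "'a::linorder \<Rightarrow> 'a list \<Rightarrow> 'a list" where
  "descent_bottoms p [] = []"
| "descent_bottoms p (x # xs) = (if x < p then x # descent_bottoms x xs else descent_bottoms x xs)"

lemma increasing_at_iff:
  "increasing_at w i j \<longleftrightarrow> i \<le> j \<and> j < length w \<and> (\<forall>k. i \<le> k \<and> k < j \<longrightarrow> w ! k \<le> w ! Suc k)"
proof -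
  have "(\<forall>k. Suc k < Suc j - i \<longrightarrow> w ! (i + k) \<le> w ! (i + Suc k)) \<longleftrightarrow>
      (\<forall>k. i \<le> k \<and> k < j \<longrightarrow> w ! k \<le> w ! Suc k)" (is "?L \<longleftrightarrow> ?R")
  proof (intro iffI allI impI)
    fix k assume ?L "i \<le> k \<and> k < j"
    then show "w ! k \<le> w ! Suc k"
      by (auto dest: spec[of _ "k - i"])
  qed auto
  moreover have "min (length w - i) (Suc j - i) = Suc j - i" if "j < length w"
    using that by simp
  ultimately show ?thesis
    unfolding increasing_at_def subword_def sorted_iff_nth_Suc
    by auto
qed

text \<open>A run can be extended to the left over any letter that is not larger than its first one, and
  from a position behind a descent (or at the very start) the longest increasing factor is maximal.\<close>
lemma run_starts_iff:
  "(\<exists>j. run_at w i j) \<longleftrightarrow> i < length w \<and> (i = 0 \<or> w ! i < w ! (i - 1))"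
proof (intro iffI conjI)
  assume "\<exists>j. run_at w i j"
  then obtain j where j: "run_at w i j" ..
  then have inc: "increasing_at w i j"
    by (simp add: run_at_def)
  then show "i < length w"
    by (auto simp: increasing_at_def)
  show "i = 0 \<or> w ! i < w ! (i - 1)"
  proof (rule ccontr)
    assume "\<not> ?thesis"
    then have "0 < i" and le: "w ! (i - 1) \<le> w ! Suc (i - 1)"
      by auto
    have "w ! k \<le> w ! Suc k" if "i - 1 \<le> k" "k < j" for k
    proof (cases "k = i - 1")
      case False
      then show ?thesis using inc that by (auto simp: increasing_at_iff)
    qed (use le in simp)
    then have "increasing_at w (i - 1) j"
      using inc by (auto simp: increasing_at_iff)
    then have "i - 1 = i"
      using j unfolding run_at_def by (metis diff_le_self order_refl)
    with \<open>0 < i\<close> show False by simp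
  qed
next
  assume i: "i < length w \<and> (i = 0 \<or> w ! i < w ! (i - 1))"
  define j where "j = (GREATEST j. increasing_at w i j)"
  have bound: "\<And>j. increasing_at w i j \<Longrightarrow> j \<le> length w"
    by (simp add: increasing_at_def)
  have "increasing_at w i i"
    using i by (auto simp: increasing_at_iff)
  then have j: "increasing_at w i j"
    unfolding j_def using bound by (rule GreatestI_nat)
  have max: "j' \<le> j" if "increasing_at w i j'" for j'
    unfolding j_def using that bound by (rule Greatest_le_nat)
  have "i' = i \<and> j' = j" if "i' \<le> i" "j \<le> j'" "increasing_at w i' j'" for i' j'
  proof -
    have "i' = i"
    proof (rule ccontr)
      assume "i' \<noteq> i"
      then have "i' \<le> i - 1" "i - 1 < j'" "0 < i"
        using that j by (auto simp: increasing_at_def)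
      then have "w ! (i - 1) \<le> w ! i"
        using that(3) by (auto simp: increasing_at_iff dest: spec[of _ "i - 1"])
      with i \<open>0 < i\<close> show False by auto
    qed
    with that max[of j'] show ?thesis by auto
  qed
  with j show "\<exists>j. run_at w i j"
    unfolding run_at_def by blast
qed

lemma map_nth_descents:
  "map ((!) w) (filter (\<lambda>i. w ! i < (p # w) ! i) [0..<length w]) = descent_bottoms p w"
proof (induction w arbitrary: p)
  case (Cons x xs)
  have "[0..<length (x # xs)] = 0 # map Suc [0..<length xs]"
    by (simp add: upt_conv_Cons map_Suc_upt del: upt_Suc)
  then show ?case
    using Cons[of x] by (simp add: filter_map o_def del: upt_Suc)
qed simp

lemma run_leaders_Cons: "run_leaders (x # xs) = x # descent_bottoms x xs"
proof -
  have "[0..<length (x # xs)] = 0 # map Suc [0..<length xs]"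
    by (simp add: upt_conv_Cons map_Suc_upt del: upt_Suc)
  moreover have "filter (\<lambda>i. Suc i < length (x # xs) \<and> P i) [0..<length xs] = filter P [0..<length xs]"
    for P by (rule filter_cong) auto
  ultimately show ?thesis
    using map_nth_descents[of xs x]
    unfolding run_leaders_def run_starts_iff by (simp add: filter_map o_def del: upt_Suc)
qed

lemma set_descent_bottoms: "set (descent_bottoms p w) \<subseteq> set w"
  by (induction w arbitrary: p) auto

lemma descent_bottoms_append:
  "descent_bottoms p (u @ v) = descent_bottoms p u @ descent_bottoms (last (p # u)) v"
  by (induction u arbitrary: p) auto

lemma descent_bottoms_eq_Nil_iff: "descent_bottoms p w = [] \<longleftrightarrow> sorted (p # w)"
  by (induction w arbitrary: p) (auto simp: not_less)

text \<open>If \<open>u\<close> is nonempty, \<open>m\<close> is a descent bottom. Descent bottoms before it are letters of \<open>u\<close> and so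
  larger than \<open>m\<close>, hence there can be none; all later ones are at least \<open>m\<close>, so only their order
  among themselves matters.\<close>
lemma sorted_descent_bottoms_split:
  fixes m :: "'a::linorder"
  assumes "p \<le> m" "\<forall>x\<in>set u. m < x" "\<forall>x\<in>set v. m \<le> x"
  shows "sorted (descent_bottoms p (u @ m # v)) \<longleftrightarrow> sorted u \<and> sorted (descent_bottoms m v)"
proof (cases "u = []")
  case True
  then show ?thesis using assms by auto
next
  case False
  have v: "\<forall>x\<in>set (descent_bottoms m v). m \<le> x"
    using assms set_descent_bottoms by fastforce
  have u: "\<forall>x\<in>set (descent_bottoms p u). m < x"
    using assms set_descent_bottoms by fastforce
  have "last (p # u) \<in> set u" using False by simp
  then have "m < last (p # u)" using assms by blast
  then have eq: "descent_bottoms p (u @ m # v) = descent_bottoms p u @ m # descent_bottoms m v"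
    by (simp add: descent_bottoms_append)
  have "sorted (descent_bottoms p (u @ m # v)) \<longleftrightarrow>
      descent_bottoms p u = [] \<and> sorted (descent_bottoms m v)"
  proof
    assume s: "sorted (descent_bottoms p (u @ m # v))"
    then have "\<forall>x\<in>set (descent_bottoms p u). x \<le> m"
      unfolding eq by (auto simp: sorted_append)
    then have "set (descent_bottoms p u) = {}" using u by (metis all_not_in_conv leD)
    then show "descent_bottoms p u = [] \<and> sorted (descent_bottoms m v)"
      using s unfolding eq by simp
  qed (use v in \<open>auto simp: eq\<close>)
  moreover have "sorted (p # u) \<longleftrightarrow> sorted u"
    using assms by (auto simp: order.trans order.strict_implies_order)
  ultimately show ?thesis
    by (simp add: descent_bottoms_eq_Nil_iff del: sorted_wrt.simps)
qed

lemma descent_bottoms_lower_predecessor: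
  assumes "\<forall>x\<in>set w. p \<le> x" "\<forall>x\<in>set w. q \<le> x"
  shows "descent_bottoms p w = descent_bottoms q w"
  using assms by (cases w) auto

section \<open>Stirling words over arbitrary alphabets\<close>

definition nested :: "'a::linorder list \<Rightarrow> bool" where
  "nested w \<longleftrightarrow> (\<forall>p q r. p < q \<and> q < r \<and> r < length w \<and> w ! p = w ! r \<longrightarrow> w ! p < w ! q)"

lemma nested_append_left:
  assumes "nested (u @ v)" shows "nested u"
  unfolding nested_def
proof (intro allI impI)
  fix p q r assume "p < q \<and> q < r \<and> r < length u \<and> u ! p = u ! r"
  then show "u ! p < u ! q"
    using assms[unfolded nested_def, rule_format, of p q r] by (simp add: nth_append)
qed

lemma nested_append_right:
  assumes "nested (u @ v)" shows "nested v"
  unfolding nested_def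
proof (intro allI impI)
  fix p q r assume "p < q \<and> q < r \<and> r < length v \<and> v ! p = v ! r"
  then show "v ! p < v ! q"
    using assms[unfolded nested_def, rule_format, of "length u + p" "length u + q" "length u + r"]
    by simp
qed

lemma nested_between:
  assumes "nested (u @ x # v @ x # v')" "y \<in> set v"
  shows "x < y"
proof -
  obtain k where k: "k < length v" "v ! k = y"
    using assms(2) by (auto simp: in_set_conv_nth)
  show ?thesis
    using assms(1)[unfolded nested_def, rule_format,
      of "length u" "length u + Suc k" "length u + Suc (length v)"] k
    by (simp add: nth_append)
qed

lemma nested_append_disjoint:
  assumes "nested u" "nested v" "set u \<inter> set v = {}"
  shows "nested (u @ v)"
  unfolding nested_def
proof (intro allI impI, elim conjE)
  fix p q r
  assume pqr: "p < q" "q < r" "r < length (u @ v)" "(u @ v) ! p = (u @ v) ! r"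
  consider "r < length u" | "length u \<le> p" | "p < length u" "length u \<le> r" by linarith
  then show "(u @ v) ! p < (u @ v) ! q"
  proof cases
    case 1
    then show ?thesis
      using pqr assms(1)[unfolded nested_def, rule_format, of p q r] by (simp add: nth_append)
  next
    case 2
    then have "p - length u < q - length u" "q - length u < r - length u" "r - length u < length v"
      using pqr by auto
    then show ?thesis
      using 2 pqr assms(2)[unfolded nested_def, rule_format,
        of "p - length u" "q - length u" "r - length u"]
      by (simp add: nth_append)
  next
    case 3
    then have "u ! p \<in> set u" "v ! (r - length u) \<in> set v"
      using pqr by (auto intro!: nth_mem)
    moreover have "u ! p = v ! (r - length u)"
      using 3 pqr by (simp add: nth_append)
    ultimately show ?thesis using assms(3) by auto
  qed
qed

lemma nested_bracket:
  assumes "nested v" "\<forall>y\<in>set v. x < y"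
  shows "nested (x # v @ [x])"
  unfolding nested_def
proof (intro allI impI, elim conjE)
  fix p q r
  let ?w = "x # v @ [x]"
  assume pqr: "p < q" "q < r" "r < length ?w" "?w ! p = ?w ! r"
  have inner: "?w ! Suc k = v ! k" if "k < length v" for k
    using that by (simp add: nth_append)
  have v: "v ! k \<noteq> x" "x < v ! k" if "k < length v" for k
    using assms(2) nth_mem[OF that] by auto
  obtain q' where q: "q = Suc q'" "q' < length v"
    using pqr by (cases q) auto
  obtain r' where r: "r = Suc r'"
    using pqr by (cases r) auto
  show "?w ! p < ?w ! q"
  proof (cases p)
    case 0
    then show ?thesis using q v inner by simp
  next
    case (Suc p')
    then have p: "p' < length v" using pqr q by simp
    have r': "r' < length v"
    proof (rule ccontr)
      assume "\<not> ?thesis"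
      then have "r' = length v" using pqr r by simp
      then show False using pqr Suc p v inner r by simp
    qed
    have nth: "?w ! p = v ! p'" "?w ! q = v ! q'" "?w ! r = v ! r'"
      using Suc q r p r' inner by metis+
    have "p' < q'" "q' < r'" using pqr Suc q r by auto
    then show ?thesis
      using pqr(4) r' assms(1)[unfolded nested_def, rule_format, of p' q' r'] unfolding nth by blast
  qed
qed

text \<open>The alphabet is an arbitrary set because the factors of a Stirling permutation of order \<open>N\<close>
  that the decomposition produces use only some of the letters \<open>1, \<dots>, N\<close>.\<close>
definition stirling_words :: "'a::linorder set \<Rightarrow> 'a list set" where
  "stirling_words S = {w. set w = S \<and> (\<forall>x\<in>S. count_list w x = 2) \<and> nested w}"

lemma length_stirling_word:
  assumes "w \<in> stirling_words S"
  shows "length w = 2 * card S"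
proof -
  have "length w = (\<Sum>x\<in>set w. count_list w x)"
    by (rule sum_count_set[symmetric]) auto
  also have "\<dots> = (\<Sum>x\<in>S. 2)"
    using assms by (auto simp: stirling_words_def intro: sum.cong)
  finally show ?thesis by simp
qed

lemma stirling_permutations_eq: "stirling_permutations N = stirling_words {1..N}"
proof (intro set_eqI iffI)
  fix w assume w: "w \<in> stirling_permutations N"
  then have "set w \<subseteq> {1..N}" "\<forall>i\<in>{1..N}. count_list w i = 2"
    by (auto simp: stirling_permutations_def)
  moreover have "x \<in> set w" if "count_list w x = 2" for x
    using that count_list_0_iff[of w x] by auto
  ultimately show "w \<in> stirling_words {1..N}"
    using w by (auto simp: stirling_permutations_def stirling_words_def nested_def)
next
  fix w assume w: "w \<in> stirling_words {1..N}"
  then have "length w = 2 * N"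
    using length_stirling_word by fastforce
  then show "w \<in> stirling_permutations N"
    using w by (auto simp: stirling_permutations_def stirling_words_def nested_def)
qed

lemma stirling_words_append:
  assumes "u \<in> stirling_words A" "v \<in> stirling_words B" "A \<inter> B = {}"
  shows "u @ v \<in> stirling_words (A \<union> B)"
proof -
  have "count_list (u @ v) x = 2" if "x \<in> A \<union> B" for x
  proof (cases "x \<in> A")
    case True
    then have "x \<notin> set v" using assms by (auto simp: stirling_words_def)
    then show ?thesis using True assms by (simp add: stirling_words_def)
  next
    case False
    then have "x \<notin> set u" using assms by (auto simp: stirling_words_def)
    then show ?thesis using False that assms by (simp add: stirling_words_def)
  qed
  moreover have "nested (u @ v)"
    using assms by (auto simp: stirling_words_def intro: nested_append_disjoint)
  ultimately show ?thesis using assms by (simp add: stirling_words_def)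
qed

lemma stirling_words_bracket:
  assumes "v \<in> stirling_words A" "\<forall>y\<in>A. m < y"
  shows "m # v @ [m] \<in> stirling_words (insert m A)"
proof -
  have "m \<notin> set v" using assms by (auto simp: stirling_words_def)
  then show ?thesis
    using assms by (auto simp: stirling_words_def intro!: nested_bracket)
qed

text \<open>The alphabets of the factors are disjoint: a letter on both sides of an \<open>m\<close> would enclose this
  \<open>m\<close> and so be smaller than it. Hence each factor keeps both copies of each of its letters.\<close>
lemma stirling_words_decompose:
  assumes w: "w \<in> stirling_words (insert m X)" and m: "\<forall>x\<in>X. m < x"
  obtains C A R u v y where
    "w = u @ m # v @ m # y" "u \<in> stirling_words C" "v \<in> stirling_words A" "y \<in> stirling_words R"
    "X = C \<union> A \<union> R" "C \<inter> A = {}" "C \<inter> R = {}" "A \<inter> R = {}"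
proof -
  have set: "set w = insert m X" and nest: "nested w"
    and cnt: "\<And>x. x \<in> insert m X \<Longrightarrow> count_list w x = 2"
    using w by (auto simp: stirling_words_def)
  have "m \<notin> X" using m by blast
  obtain u t where ut: "w = u @ m # t" "m \<notin> set u"
    using split_list_first[of m w] set by auto
  then have "count_list t m = 1" using cnt[of m] by simp
  then have "m \<in> set t" using count_list_0_iff[of t m] by force
  then obtain v y where vy: "t = v @ m # y" "m \<notin> set v"
    using split_list_first[of m t] by auto
  have "m \<notin> set y"
    using \<open>count_list t m = 1\<close> vy count_list_0_iff[of y m] by simp
  have weq: "w = u @ m # v @ m # y" using ut vy by simp
  have X: "X = set u \<union> set v \<union> set y"
    using set weq ut vy \<open>m \<notin> set y\<close> \<open>m \<notin> X\<close> by auto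
  have across: False if s: "w = s @ m # s'" "x \<in> set s" "x \<in> set s'" "x \<in> X" for s s' x
  proof -
    obtain s1 s2 where "s = s1 @ x # s2" using s(2) by (meson split_list)
    moreover obtain s3 s4 where "s' = s3 @ x # s4" using s(3) by (meson split_list)
    ultimately have "w = s1 @ x # (s2 @ m # s3) @ x # s4" using s(1) by simp
    with nest have "x < m" by (auto intro: nested_between[of s1 x "s2 @ m # s3" s4])
    with m s(4) show False by auto
  qed
  have disj: "set u \<inter> set v = {}" "set u \<inter> set y = {}" "set v \<inter> set y = {}"
    using across[of u "v @ m # y"] across[of "u @ m # v" y] weq X by auto
  have count: "count_list w x = count_list u x + count_list v x + count_list y x" if "x \<in> X" for x
    using that \<open>m \<notin> X\<close> weq by auto
  have "nested u"
    using nest unfolding weq by (rule nested_append_left)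
  moreover have "nested y"
    using nest nested_append_right[of "u @ m # v @ [m]" y] by (simp add: weq)
  moreover have "nested v"
    using nest nested_append_right[of "u @ [m]" "v @ m # y"] nested_append_left[of v "m # y"]
    by (simp add: weq)
  moreover have "count_list u x = 2" if "x \<in> set u" for x
    using that count[of x] cnt[of x] disj X
    by (metis Un_iff add.right_neutral count_list_0_iff disjoint_iff insertI2)
  moreover have "count_list v x = 2" if "x \<in> set v" for x
    using that count[of x] cnt[of x] disj X
    by (metis Un_iff add.right_neutral add.left_neutral count_list_0_iff disjoint_iff insertI2)
  moreover have "count_list y x = 2" if "x \<in> set y" for x
    using that count[of x] cnt[of x] disj X
    by (metis Un_iff add.left_neutral count_list_0_iff disjoint_iff insertI2)
  ultimately show ?thesis
    using that[OF weq, of "set u" "set v" "set y"] X disj by (auto simp: stirling_words_def)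
qed

lemma stirling_words_compose:
  assumes "u \<in> stirling_words C" "v \<in> stirling_words A" "y \<in> stirling_words R"
    "C \<inter> A = {}" "C \<inter> R = {}" "A \<inter> R = {}" "\<forall>x\<in>C \<union> A \<union> R. m < x"
  shows "u @ m # v @ m # y \<in> stirling_words (insert m (C \<union> A \<union> R))"
proof -
  have "m # v @ [m] \<in> stirling_words (insert m A)"
    using assms by (intro stirling_words_bracket) auto
  then have "(m # v @ [m]) @ y \<in> stirling_words (insert m A \<union> R)"
    using assms by (intro stirling_words_append) auto
  then have "u @ (m # v @ [m]) @ y \<in> stirling_words (C \<union> (insert m A \<union> R))"
    using assms by (intro stirling_words_append[OF assms(1)]) auto
  then show ?thesis by (simp add: Un_assoc)
qed

section \<open>Sorted Stirling words\<close>

text \<open>Put two copies of each new least letter in front.\<close>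
lemma ex_sorted_stirling_word:
  assumes "finite X"
  shows "\<exists>w \<in> stirling_words X. sorted w"
  using assms
proof (induction rule: finite_linorder_min_induct)
  case empty
  show ?case by (auto simp: stirling_words_def nested_def)
next
  case (insert m X)
  then obtain w where w: "w \<in> stirling_words X" "sorted w" by auto
  have "[] \<in> stirling_words {}" by (simp add: stirling_words_def nested_def)
  then have "[] @ m # [] @ m # w \<in> stirling_words (insert m ({} \<union> {} \<union> X))"
    using w insert by (intro stirling_words_compose) auto
  moreover have "sorted (m # m # w)"
    using w insert by (auto simp: stirling_words_def)
  ultimately show ?case by (intro bexI[of _ "m # m # w"]) auto
qed

lemma sorted_stirling_word_unique:
  assumes "v \<in> stirling_words X" "sorted v" "w \<in> stirling_words X" "sorted w"
  shows "v = w"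
proof -
  have "count_list v x = count_list w x" for x
  proof (cases "x \<in> X")
    case False
    then have "x \<notin> set v" "x \<notin> set w" using assms by (auto simp: stirling_words_def)
    then show ?thesis by simp
  qed (use assms in \<open>simp add: stirling_words_def\<close>)
  then have "mset v = mset w"
    by (auto simp: multiset_eq_iff count_mset)
  then show ?thesis
    using assms by (metis properties_for_sort)
qed

definition sorted_word :: "'a::linorder set \<Rightarrow> 'a list" where
  "sorted_word X = (THE w. w \<in> stirling_words X \<and> sorted w)"

lemma sorted_word_iff:
  assumes "finite X"
  shows "w \<in> stirling_words X \<and> sorted w \<longleftrightarrow> w = sorted_word X"
proof -
  have "\<exists>!w. w \<in> stirling_words X \<and> sorted w"
    using ex_sorted_stirling_word[OF assms] sorted_stirling_word_unique by blast
  then show ?thesis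
    unfolding sorted_word_def by (metis (no_types, lifting) theI')
qed

lemma sorted_word_props:
  assumes "finite X"
  shows "sorted_word X \<in> stirling_words X" "sorted (sorted_word X)" "set (sorted_word X) = X"
  using sorted_word_iff[OF assms, of "sorted_word X"] by (auto simp: stirling_words_def)

section \<open>Words whose later runs have increasing leaders\<close>

text \<open>Since no letter is below \<open>0\<close>, the virtual predecessor \<open>0\<close> keeps the first letter from counting as
  a descent bottom; the condition concerns the leaders of all runs but the first.\<close>
definition tail_flattened :: "nat set \<Rightarrow> nat list set" where
  "tail_flattened S = {w \<in> stirling_words S. sorted (descent_bottoms 0 w)}"

text \<open>Every letter is at least the leader of its run, so bounding the leaders bounds all letters.\<close>
lemma descent_bottoms_bound:
  assumes "a \<le> p" "\<forall>b\<in>set (descent_bottoms p w). a \<le> b"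
  shows "\<forall>y\<in>set w. a \<le> y"
  using assms
proof (induction w arbitrary: p)
  case (Cons x w)
  have "a \<le> x"
  proof (cases "x < p")
    case False
    then show ?thesis using Cons.prems(1) by simp
  qed (use Cons.prems(2) in simp)
  moreover have "\<forall>b\<in>set (descent_bottoms x w). a \<le> b"
    using Cons.prems(2) by simp
  ultimately show ?case using Cons.IH[of x] by simp
qed simp

text \<open>In a flattened word the first leader is the least of all leaders, hence the least letter.\<close>
lemma flattened_stirling_word_iff:
  assumes w: "w \<in> stirling_words (insert m X)" and m: "\<forall>x\<in>X. (m::nat) < x"
  shows "flattened w \<longleftrightarrow> w \<in> tail_flattened (insert m X) \<and> hd w = m"
proof -
  have set: "set w = insert m X" using w by (simp add: stirling_words_def)
  then obtain x xs where xs: "w = x # xs" by (cases w) auto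
  have flat: "flattened w \<longleftrightarrow> sorted (x # descent_bottoms x xs)"
    by (simp add: flattened_def xs run_leaders_Cons)
  have "x = m" if "\<forall>b\<in>set (descent_bottoms x xs). x \<le> b"
  proof -
    have "x \<le> m" using descent_bottoms_bound[OF order_refl that] set xs by auto
    moreover have "x \<in> insert m X" using set xs by auto
    ultimately show ?thesis using m by auto
  qed
  moreover have "\<forall>b\<in>set (descent_bottoms x xs). x \<le> b" if "x = m"
    using that set_descent_bottoms[of x xs] set xs m by fastforce
  ultimately have "flattened w \<longleftrightarrow> sorted (descent_bottoms x xs) \<and> x = m"
    unfolding flat sorted_simps by blast
  moreover have "descent_bottoms 0 w = descent_bottoms x xs" "hd w = x"
    by (simp_all add: xs)
  ultimately show ?thesis
    using w unfolding tail_flattened_def by simp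
qed

text \<open>Split at the first \<open>m\<close> with predecessor \<open>0\<close>, then at the second \<open>m\<close> with predecessor \<open>m\<close>. As
  all letters of \<open>y\<close> exceed \<open>m\<close>, the predecessor \<open>m\<close> in front of \<open>y\<close> may be replaced by \<open>0\<close>.\<close>
lemma sorted_descent_bottoms_blocks:
  fixes m :: nat
  assumes "\<forall>x\<in>set u \<union> set v \<union> set y. m < x"
  shows "sorted (descent_bottoms 0 (u @ m # v @ m # y)) \<longleftrightarrow>
    sorted u \<and> sorted v \<and> sorted (descent_bottoms 0 y)"
proof -
  have "sorted (descent_bottoms 0 (u @ m # v @ m # y)) \<longleftrightarrow>
      sorted u \<and> sorted (descent_bottoms m (v @ m # y))"
    using assms by (intro sorted_descent_bottoms_split) (auto simp: less_imp_le)
  also have "sorted (descent_bottoms m (v @ m # y)) \<longleftrightarrow> sorted v \<and> sorted (descent_bottoms m y)"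
    using assms by (intro sorted_descent_bottoms_split) (auto simp: less_imp_le)
  also have "descent_bottoms m y = descent_bottoms 0 y"
    using assms by (intro descent_bottoms_lower_predecessor) (auto simp: less_imp_le)
  finally show ?thesis .
qed

lemma append_first_eq_iff:
  assumes "x \<notin> set u" "x \<notin> set u'"
  shows "u @ x # v = u' @ x # v' \<longleftrightarrow> u = u' \<and> v = v'"
  using assms
proof (induction u arbitrary: u')
  case Nil
  then show ?case by (cases u') auto
next
  case (Cons a u)
  then show ?case by (cases u') auto
qed

text \<open>The set \<open>C\<close> holds the letters before the first \<open>m\<close>, and \<open>R\<close> those after the second one, which form
  the word \<open>y\<close>; the other letters of \<open>X\<close> go between the two occurrences of \<open>m\<close>.\<close>
definition assemble :: "nat \<Rightarrow> nat set \<Rightarrow> nat set \<times> nat set \<times> nat list \<Rightarrow> nat list" where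
  "assemble m X = (\<lambda>(R, C, y). sorted_word C @ m # sorted_word (X - R - C) @ m # y)"

text \<open>The two marks \<open>m\<close> can be located in an assembled word, so its three factors and their alphabets
  can be read off. Every tail-flattened word is assembled because its first two factors are sorted
  and therefore determined by their alphabets.\<close>
lemma bij_betw_assemble:
  assumes "finite X" and m: "\<forall>x\<in>X. m < x"
  shows "bij_betw (assemble m X) (SIGMA R:Pow X. Pow (X - R) \<times> tail_flattened R)
    (tail_flattened (insert m X))"
  unfolding bij_betw_def
proof
  have fin: "finite A" if "A \<subseteq> X" for A
    using that assms(1) by (rule finite_subset)
  have "m \<notin> X" using m by blast
  have word: "set y = R" if "y \<in> tail_flattened R" for y R
    using that by (auto simp: tail_flattened_def stirling_words_def)
  show "inj_on (assemble m X) (SIGMA R:Pow X. Pow (X - R) \<times> tail_flattened R)"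
  proof (rule inj_onI)
    fix d d'
    assume "d \<in> (SIGMA R:Pow X. Pow (X - R) \<times> tail_flattened R)"
      "d' \<in> (SIGMA R:Pow X. Pow (X - R) \<times> tail_flattened R)"
      and eq_d: "assemble m X d = assemble m X d'"
    then obtain R C y R' C' y' where d: "d = (R, C, y)" "d' = (R', C', y')"
      and sub: "R \<subseteq> X" "C \<subseteq> X - R" "R' \<subseteq> X" "C' \<subseteq> X - R'"
      and y: "y \<in> tail_flattened R" "y' \<in> tail_flattened R'"
      by blast
    note eq = eq_d[unfolded d]
    have set: "set (sorted_word A) = A" if "A \<subseteq> X" for A
      using that fin by (simp add: sorted_word_props)
    have sets: "set (sorted_word C) = C" "set (sorted_word C') = C'"
      "set (sorted_word (X - R - C)) = X - R - C" "set (sorted_word (X - R' - C')) = X - R' - C'"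
      using sub by (auto intro!: set)
    have "m \<notin> set (sorted_word C)" "m \<notin> set (sorted_word C')"
      "m \<notin> set (sorted_word (X - R - C))" "m \<notin> set (sorted_word (X - R' - C'))"
      unfolding sets using \<open>m \<notin> X\<close> sub by blast+
    note split = append_first_eq_iff[OF this(1,2)] append_first_eq_iff[OF this(3,4)]
    have "sorted_word C = sorted_word C'" "y = y'"
      using eq unfolding assemble_def prod.case split by blast+
    moreover have "C = C'" "R = R'"
      using calculation sets(1,2) word[OF y(1)] word[OF y(2)] by argo+
    ultimately show "d = d'"
      unfolding d by blast
  qed
  show "assemble m X ` (SIGMA R:Pow X. Pow (X - R) \<times> tail_flattened R) = tail_flattened (insert m X)"
  proof (intro equalityI subsetI)
    fix w assume "w \<in> assemble m X ` (SIGMA R:Pow X. Pow (X - R) \<times> tail_flattened R)"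
    then obtain R C y where R: "R \<subseteq> X" "C \<subseteq> X - R" and y: "y \<in> tail_flattened R"
      and w: "w = assemble m X (R, C, y)" by auto
    let ?A = "X - R - C"
    have C: "finite C" and A: "finite ?A" using R by (auto intro: fin)
    have X: "X = C \<union> ?A \<union> R" using R by auto
    have "w \<in> stirling_words (insert m (C \<union> ?A \<union> R))"
      using R y m sorted_word_props[OF C] sorted_word_props[OF A] unfolding w assemble_def prod.case
      by (intro stirling_words_compose) (auto simp: tail_flattened_def)
    moreover have "sorted (descent_bottoms 0 w)"
      unfolding w assemble_def prod.case
      using R y m word[OF y] sorted_word_props[OF C] sorted_word_props[OF A]
      by (subst sorted_descent_bottoms_blocks) (auto simp: tail_flattened_def)
    ultimately show "w \<in> tail_flattened (insert m X)"
      using X by (simp add: tail_flattened_def)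
  next
    fix w assume w: "w \<in> tail_flattened (insert m X)"
    then have "w \<in> stirling_words (insert m X)" by (simp add: tail_flattened_def)
    from stirling_words_decompose[OF this m] obtain C A R u v y where
      weq: "w = u @ m # v @ m # y"
      and uvy: "u \<in> stirling_words C" "v \<in> stirling_words A" "y \<in> stirling_words R"
      and X: "X = C \<union> A \<union> R" "C \<inter> A = {}" "C \<inter> R = {}" "A \<inter> R = {}" .
    have "\<forall>x\<in>set u \<union> set v \<union> set y. m < x"
      using uvy X m by (auto simp: stirling_words_def)
    then have "sorted u" "sorted v" "sorted (descent_bottoms 0 y)"
      using w unfolding weq tail_flattened_def by (auto simp: sorted_descent_bottoms_blocks)
    then have "u = sorted_word C" "v = sorted_word A" "y \<in> tail_flattened R"
      using uvy sorted_word_iff[of C u] sorted_word_iff[of A v] X fin[of C] fin[of A]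
      by (auto simp: tail_flattened_def)
    moreover have "A = X - R - C" using X by auto
    ultimately have "w = assemble m X (R, C, y)"
      by (simp add: assemble_def weq)
    moreover have "(R, C, y) \<in> (SIGMA R:Pow X. Pow (X - R) \<times> tail_flattened R)"
      using X \<open>y \<in> tail_flattened R\<close> by auto
    ultimately show "w \<in> assemble m X ` (SIGMA R:Pow X. Pow (X - R) \<times> tail_flattened R)"
      by blast
  qed
qed

section \<open>Counting\<close>

lemma finite_stirling_words:
  assumes "finite S"
  shows "finite (stirling_words S)"
proof (rule finite_subset)
  show "stirling_words S \<subseteq> {w. set w \<subseteq> S \<and> length w = 2 * card S}"
    using length_stirling_word by (auto simp: stirling_words_def)
qed (use assms finite_lists_length_eq in blast)

lemma finite_tail_flattened: "finite S \<Longrightarrow> finite (tail_flattened S)"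
  by (simp add: tail_flattened_def finite_stirling_words)

text \<open>Induction on \<open>S\<close>: the bijection reduces the count to alphabets \<open>R\<close> without the least letter, and
  the \<open>2 ^ (card X - card R)\<close> choices of \<open>C\<close> match the factor in the recurrence.\<close>
lemma card_tail_flattened:
  assumes "finite S"
  shows "card (tail_flattened S) = weighted_Bell (card S)"
  using assms
proof (induction rule: finite_psubset_induct)
  case (psubset S)
  show ?case
  proof (cases "S = {}")
    case True
    have "w \<in> tail_flattened {} \<longleftrightarrow> w = []" for w
      by (cases w) (simp_all add: tail_flattened_def stirling_words_def nested_def)
    then have "tail_flattened {} = {[]}"
      by blast
    then have "card (tail_flattened S) = 1"
      unfolding True by simp
    then show ?thesis unfolding True by (simp add: weighted_Bell_def)
  next
    case False
    define m where "m = Min S"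
    define X where "X = S - {m}"
    have "m \<in> S" and min: "\<forall>x\<in>S. m \<le> x"
      using False psubset.hyps by (simp_all add: m_def)
    then have S: "S = insert m X" "m \<notin> X"
      unfolding X_def by blast+
    have m: "\<forall>x\<in>X. m < x"
      using min unfolding X_def by (auto simp: order.strict_iff_order)
    have X: "finite X"
      using psubset.hyps by (simp add: X_def)
    have fin: "finite R" if "R \<subseteq> X" for R
      using that X by (rule finite_subset)
    have "card (tail_flattened S) = (\<Sum>R\<in>Pow X. card (Pow (X - R) \<times> tail_flattened R))"
      using bij_betw_same_card[OF bij_betw_assemble[OF X m]] X fin
      by (simp add: S finite_tail_flattened)
    also have "\<dots> = (\<Sum>R\<in>Pow X. 2 ^ (card X - card R) * weighted_Bell (card R))"
      using psubset.IH S X fin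
      by (intro sum.cong refl) (auto simp: card_cartesian_product card_Pow card_Diff_subset)
    also have "\<dots> = weighted_Bell (Suc (card X))"
      using sum_Pow_card[OF X, of "\<lambda>j. 2 ^ (card X - j) * weighted_Bell j"]
      by (simp add: weighted_Bell_Suc)
    finally show ?thesis using S X by simp
  qed
qed

text \<open>The assembled word starts with \<open>m\<close> precisely when no letter is placed before the first \<open>m\<close>, so
  only the choice of \<open>R\<close> and of the word over \<open>R\<close> remains.\<close>
lemma card_flattened_stirling_words:
  fixes m :: nat
  assumes X: "finite X" and m: "\<forall>x\<in>X. m < x"
  shows "card (flat (stirling_words (insert m X))) =
    (\<Sum>j\<le>card X. (card X choose j) * weighted_Bell j)"
proof -
  let ?D = "SIGMA R:Pow X. Pow (X - R) \<times> tail_flattened R"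
  let ?E = "SIGMA R:Pow X. {{} :: nat set} \<times> tail_flattened R"
  have fin: "finite R" if "R \<subseteq> X" for R
    using that X by (rule finite_subset)
  note bij = bij_betw_assemble[OF X m]
  have hd: "hd (assemble m X (R, C, y)) = m \<longleftrightarrow> C = {}" if "C \<subseteq> X" for R C y
  proof (cases "C = {}")
    case True
    have "set (sorted_word {}) = {}" by (simp only: sorted_word_props finite.emptyI)
    then have "sorted_word {} = ([] :: nat list)" by simp
    then show ?thesis using True unfolding assemble_def by simp
  next
    case False
    have "set (sorted_word C) = C" using that fin by (simp add: sorted_word_props)
    then have ne: "sorted_word C \<noteq> []" using False by (metis set_empty)
    then have "hd (sorted_word C) \<in> C"
      using hd_in_set \<open>set (sorted_word C) = C\<close> by metis
    then have "hd (sorted_word C) \<noteq> m" using that m by blast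
    then show ?thesis using ne False by (simp add: assemble_def)
  qed
  have "flat (stirling_words (insert m X)) = {w \<in> tail_flattened (insert m X). hd w = m}"
    using flattened_stirling_word_iff[OF _ m] by (auto simp: flat_def tail_flattened_def)
  also have "\<dots> = {w \<in> assemble m X ` ?D. hd w = m}"
    using bij by (simp add: bij_betw_def)
  also have "\<dots> = assemble m X ` {d \<in> ?D. hd (assemble m X d) = m}"
    by blast
  also have "{d \<in> ?D. hd (assemble m X d) = m} = ?E"
    using hd by blast
  finally have "flat (stirling_words (insert m X)) = assemble m X ` ?E" .
  moreover have "inj_on (assemble m X) ?E"
    using bij_betw_imp_inj_on[OF bij] by (rule inj_on_subset) blast
  ultimately have "card (flat (stirling_words (insert m X))) = card ?E"
    by (simp add: card_image)
  also have "\<dots> = (\<Sum>R\<in>Pow X. weighted_Bell (card R))"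
    using X fin by (simp add: finite_tail_flattened card_cartesian_product card_tail_flattened)
  also have "\<dots> = (\<Sum>j\<le>card X. (card X choose j) * weighted_Bell j)"
    using X by (rule sum_Pow_card)
  finally show ?thesis .
qed

theorem theorem4p6:
  fixes n :: nat
  shows "card (flat (stirling_permutations (n + 1))) =
    (\<Sum>i=0..n. (n choose i) * (\<Sum>k=0..n - i. 2 ^ (n - i - k) * Stirling (n - i) k))"
proof -
  have "{1..n + 1} = insert 1 {2..n + 1}" by auto
  then have "card (flat (stirling_permutations (n + 1))) =
      (\<Sum>j\<le>n. (n choose j) * weighted_Bell j)"
    using card_flattened_stirling_words[of "{2..n + 1}" 1]
    by (simp add: stirling_permutations_eq)
  also have "\<dots> = (\<Sum>i\<le>n. (n choose (n - i)) * weighted_Bell (n - i))"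
    using sum.atLeastAtMost_rev[of "\<lambda>j. (n choose j) * weighted_Bell j" 0 n]
    by (simp add: atMost_atLeast0)
  also have "\<dots> = (\<Sum>i\<le>n. (n choose i) * weighted_Bell (n - i))"
    by (intro sum.cong refl) (simp flip: binomial_symmetric)
  finally show ?thesis
    by (simp add: weighted_Bell_def atMost_atLeast0)
qed

end
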